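(* For each integer $n\ge 1$ let $S_n=\{(x_1,\dots,x_n)\in\mathbb{R}^n: \sum_{i=1}^n x_i\leq 1,\ x_i\geq 0 \text{ for } i=1,\dots,n\}$. Then $$\lim_{n\to\infty}\gamma_{2^n}(S_n)\leq \frac{1}{1+c_1},$$ where $c_1=0.2938\cdots$ is the solution of $\frac{(1+c)^{1+c}}{c^c}=2$.
   Context: For a convex body $K\subset\mathbb{R}^n$ (a compact convex set with non-empty interior) and a positive integer $m$, Hadwiger's covering functional is $$\gamma_m(K)=\min\Big\{\lambda>0:\ \exists\, u_1,\dots,u_m\in\mathbb{R}^n \text{ such that } K\subseteq \bigcup_{i=1}^m(\lambda K+u_i)\Big\},$$ i.e. the smallest $\lambda$ such that $K$ can be covered by $m$ translates of $\lambda K$. *)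

theory Defs
  imports "HOL-Analysis.Analysis"
begin

text \<open>
  Since the dimension varies, \<open>\<real>\<^sup>n\<close> is the carrier of the library's \<open>Euclidean_space n\<close>:
  functions \<open>nat \<Rightarrow> real\<close> vanishing outside \<open>{..<n}\<close>. Coordinates are thus numbered
  \<open>0, \<dots>, n - 1\<close>.
\<close>

abbreviation Rn :: "nat \<Rightarrow> (nat \<Rightarrow> real) set" where
  "Rn n \<equiv> topspace (Euclidean_space n)"

definition homothet :: "real \<Rightarrow> (nat \<Rightarrow> real) set \<Rightarrow> (nat \<Rightarrow> real) \<Rightarrow> (nat \<Rightarrow> real) set" where
  "homothet t K u = (\<lambda>x i. t * x i + u i) ` K"

text \<open>
  On \<open>real\<close>, \<open>LEAST\<close> denotes the minimum if it is attained and is unspecified otherwise. It is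
  attained for every convex body \<open>K\<close> in \<open>\<real>\<^sup>n\<close> with \<open>n \<ge> 1\<close> and every \<open>m \<ge> 1\<close>.
\<close>

definition covering_functional :: "nat \<Rightarrow> nat \<Rightarrow> (nat \<Rightarrow> real) set \<Rightarrow> real" where
  "covering_functional n m K =
     (LEAST t. 0 < t \<and>
        (\<exists>u :: nat \<Rightarrow> nat \<Rightarrow> real. (\<forall>j<m. u j \<in> Rn n) \<and> K \<subseteq> (\<Union>j<m. homothet t K (u j))))"

definition corner_simplex :: "nat \<Rightarrow> (nat \<Rightarrow> real) set" where
  "corner_simplex n = {x \<in> Rn n. (\<Sum>i<n. x i) \<le> 1 \<and> (\<forall>i<n. 0 \<le> x i)}"

text \<open>Positivity of \<open>c\<close> is explicit because \<open>powr\<close> is only meaningful for positive bases.\<close>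

definition is_c1 :: "real \<Rightarrow> bool" where
  "is_c1 c \<longleftrightarrow> 0 < c \<and> (1 + c) powr (1 + c) / c powr c = 2"

definition c1 :: real where
  "c1 = (THE c. is_c1 c)"

end

theory Submission
  imports Defs
begin

text \<open>
  A point \<open>x\<close> lies in \<open>t S\<^sub>n + u\<close> iff \<open>u \<le> x\<close> coordinatewise and \<open>\<Sum>(x - u) \<le> t\<close>.

  Upper bound: for \<open>y\<close> in \<open>(n + k) S\<^sub>n\<close> round all coordinates down, then decrease some of them further
  until their sum is at most \<open>k\<close>; the resulting lattice point \<open>a\<close> satisfies \<open>\<Sum>(y - a) \<le> n\<close>. So \<open>S\<^sub>n\<close>
  is covered by \<open>(n + k) choose n\<close> translates of ratio \<open>n / (n + k)\<close>, and for \<open>k \<le> c\<^sub>1 n\<close> there are at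
  most \<open>2\<^sup>n\<close> of them.

  Convergence: let \<open>\<gamma>\<^sub>n\<close> be the least ratio for \<open>2\<^sup>n\<close> translates of \<open>S\<^sub>n\<close>. Then
  \<open>\<gamma>\<^sub>n \<le> \<gamma>\<^sub>m + \<epsilon>\<close> holds for every large \<open>m\<close> and all sufficiently large \<open>n\<close>. Split the
  coordinates into blocks of size \<open>m\<close>, round the masses of the blocks up to a grid and cover each block
  by scaled copies of an optimal cover of \<open>S\<^sub>m\<close>. This costs a small factor in the ratio and a factor
  \<open>2\<^bsup>O(n/m)\<^esup>\<close> in the number of translates. The latter is won back by splitting the coordinates into \<open>B\<close>
  large blocks and using \<open>u = 0\<close> on the lightest one, which has mass at most \<open>1/B\<close>: this adds \<open>1/B\<close> to
  the ratio but leaves only the dimension \<open>n - n/B\<close> to be covered.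
\<close>

subsection \<open>Covers of simplices over finite index sets\<close>

text \<open>An arbitrary index set allows grids of blocks, and grids with one block removed, to be
  covered directly; only their cardinality matters for \<open>coverable\<close>.\<close>

definition simplex_cover :: "'a set \<Rightarrow> real \<Rightarrow> ('a \<Rightarrow> real) set \<Rightarrow> bool" where
  "simplex_cover I t U \<longleftrightarrow>
     (\<forall>x. (\<forall>i\<in>I. 0 \<le> x i) \<and> sum x I \<le> 1 \<longrightarrow>
        (\<exists>u\<in>U. (\<forall>i\<in>I. u i \<le> x i) \<and> (\<Sum>i\<in>I. x i - u i) \<le> t))"

text \<open>No sign condition on \<open>t\<close>: admitting \<open>t = 0\<close> makes the set of
  feasible ratios closed, so that compactness yields a minimum. Positivity is recovered later
  through \<open>not_coverable_zero\<close>.\<close>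

definition coverable :: "nat \<Rightarrow> nat \<Rightarrow> real \<Rightarrow> bool" where
  "coverable n M t \<longleftrightarrow>
     (\<exists>U :: (nat \<Rightarrow> real) set. finite U \<and> card U \<le> M \<and> simplex_cover {..<n} t U)"

lemma simplex_coverE:
  assumes "simplex_cover I t U" "\<forall>i\<in>I. 0 \<le> x i" "sum x I \<le> 1"
  obtains u where "u \<in> U" "\<forall>i\<in>I. u i \<le> x i" "(\<Sum>i\<in>I. x i - u i) \<le> t"
  using assms unfolding simplex_cover_def by blast

text \<open>Embed \<open>I\<close> into \<open>J\<close> by an injection \<open>f\<close>, extend
  points by zero to \<open>J\<close>, and pull the covering vectors back along
  \<open>f\<close>.\<close>

lemma simplex_cover_reindex:
  assumes fin: "finite I" "finite J" and card: "card I \<le> card J"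
    and U: "finite U" "card U \<le> M" "simplex_cover J t U"
  obtains V where "finite V" "card V \<le> M" "simplex_cover I t V"
proof -
  obtain f where f: "inj_on f I" "f ` I \<subseteq> J"
    using card_le_inj[OF fin card] by blast
  let ?V = "(\<lambda>u. u \<circ> f) ` U"
  have "simplex_cover I t ?V"
    unfolding simplex_cover_def
  proof (intro allI impI)
    fix x :: "'a \<Rightarrow> real"
    assume x: "(\<forall>i\<in>I. 0 \<le> x i) \<and> sum x I \<le> 1"
    define y where "y = (\<lambda>j. if j \<in> f ` I then x (the_inv_into I f j) else 0)"
    have yf: "y (f i) = x i" if "i \<in> I" for i
      using that f by (simp add: y_def the_inv_into_f_f)
    have "sum y J = sum y (f ` I)"
      using fin f by (intro sum.mono_neutral_right) (auto simp: y_def)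
    also have "\<dots> = sum x I"
      using f yf by (simp add: sum.reindex)
    finally have sum: "sum y J \<le> 1" using x by simp
    have pos: "\<forall>j\<in>J. 0 \<le> y j"
      using x f by (auto simp: y_def the_inv_into_f_f)
    obtain u where u: "u \<in> U" "\<forall>j\<in>J. u j \<le> y j" "(\<Sum>j\<in>J. y j - u j) \<le> t"
      by (rule simplex_coverE[OF U(3) pos sum])
    have "(\<Sum>i\<in>I. x i - (u \<circ> f) i) = (\<Sum>j\<in>f ` I. y j - u j)"
      using f yf by (simp add: sum.reindex)
    \<comment> \<open>All terms \<open>y j - u j\<close> are nonnegative, so dropping the
      coordinates outside the image of \<open>f\<close> can only lower the sum.\<close>
    also have "\<dots> \<le> (\<Sum>j\<in>J. y j - u j)"
      using fin f u by (intro sum_mono2) auto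
    also have "\<dots> \<le> t" by (rule u)
    finally have "(\<Sum>i\<in>I. x i - (u \<circ> f) i) \<le> t" .
    moreover have "\<forall>i\<in>I. (u \<circ> f) i \<le> x i"
      using u(2) f(2) yf by force
    ultimately show "\<exists>v\<in>?V. (\<forall>i\<in>I. v i \<le> x i) \<and> (\<Sum>i\<in>I. x i - v i) \<le> t"
      using u(1) by blast
  qed
  moreover have "finite ?V" "card ?V \<le> M"
    using U card_image_le[of U] by (auto intro: le_trans)
  ultimately show thesis using that by blast
qed

lemma coverableI:
  assumes "finite I" "n \<le> card I" "finite U" "card U \<le> M" "simplex_cover I t U"
  shows "coverable n M t"
proof -
  have "card {..<n} \<le> card I" using assms(2) by simp
  from simplex_cover_reindex[OF finite_lessThan assms(1) this assms(3-5)]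
  obtain V where "finite V" "card V \<le> M" "simplex_cover {..<n} t V" .
  then show ?thesis unfolding coverable_def by blast
qed

lemma coverableE:
  assumes "coverable n M t" "finite I" "card I \<le> n"
  obtains U where "finite U" "card U \<le> M" "simplex_cover I t U"
proof -
  obtain U' :: "(nat \<Rightarrow> real) set"
    where U': "finite U'" "card U' \<le> M" "simplex_cover {..<n} t U'"
    using assms(1) unfolding coverable_def by blast
  have "card I \<le> card {..<n}" using assms(3) by simp
  from simplex_cover_reindex[OF assms(2) finite_lessThan this U'] show thesis
    using that .
qed

lemma simplex_cover_scale:
  assumes "simplex_cover I t U" "finite I" "0 \<le> a" "\<forall>i\<in>I. 0 \<le> x i" "sum x I \<le> a"
  obtains u where "u \<in> U" "\<forall>i\<in>I. a * u i \<le> x i" "(\<Sum>i\<in>I. x i - a * u i) \<le> a * t"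
proof (cases "a = 0")
  case True
  have "sum x I = 0"
    using assms True by (metis sum_nonneg order_antisym)
  then have "\<forall>i\<in>I. x i = 0"
    using assms sum_nonneg_eq_0_iff by blast
  \<comment> \<open>Any member of \<open>U\<close> serves, since it is multiplied by
    \<open>a = 0\<close>; covering the origin shows that \<open>U\<close> is nonempty.\<close>
  moreover obtain u where "u \<in> U"
    using simplex_coverE[OF assms(1), of "\<lambda>_. 0"] by auto
  ultimately show thesis using that True by simp
next
  case False
  then have a: "0 < a" using assms by simp
  have "\<forall>i\<in>I. 0 \<le> x i / a" "(\<Sum>i\<in>I. x i / a) \<le> 1"
    using assms a by (simp_all add: sum_divide_distrib[symmetric])
  from simplex_coverE[OF assms(1) this]
  obtain u where u: "u \<in> U" "\<forall>i\<in>I. u i \<le> x i / a" "(\<Sum>i\<in>I. x i / a - u i) \<le> t" .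
  have "(\<Sum>i\<in>I. x i - a * u i) = a * (\<Sum>i\<in>I. x i / a - u i)"
    using a by (simp add: sum_distrib_left right_diff_distrib)
  also have "\<dots> \<le> a * t"
    using u(3) a by (intro mult_left_mono) auto
  finally have "(\<Sum>i\<in>I. x i - a * u i) \<le> a * t" .
  moreover have "\<forall>i\<in>I. a * u i \<le> x i"
    using u(2) a by (simp add: pos_le_divide_eq mult.commute)
  ultimately show thesis using that u(1) by blast
qed

lemma coverable_mono:
  assumes "coverable n' M' t'" "n \<le> n'" "M' \<le> M" "t' \<le> t"
  shows "coverable n M t"
proof -
  obtain U :: "(nat \<Rightarrow> real) set"
    where U: "finite U" "card U \<le> M'" "simplex_cover {..<n'} t' U"
    using assms(1) unfolding coverable_def by blast
  have "simplex_cover {..<n'} t U"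
    unfolding simplex_cover_def
  proof (intro allI impI)
    fix x :: "nat \<Rightarrow> real"
    assume "(\<forall>i\<in>{..<n'}. 0 \<le> x i) \<and> sum x {..<n'} \<le> 1"
    then obtain u where "u \<in> U" "\<forall>i\<in>{..<n'}. u i \<le> x i" "(\<Sum>i<n'. x i - u i) \<le> t'"
      using simplex_coverE[OF U(3)] by blast
    then show "\<exists>u\<in>U. (\<forall>i\<in>{..<n'}. u i \<le> x i) \<and> (\<Sum>i<n'. x i - u i) \<le> t"
      using assms(4) order_trans by blast
  qed
  then show ?thesis
  proof (rule coverableI[OF finite_lessThan _ U(1), rotated 2])
    show "n \<le> card {..<n'}" using assms(2) by simp
    show "card U \<le> M" using U(2) assms(3) by simp
  qed
qed

section \<open>Lattice covers and their cardinality\<close>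

text \<open>Prepending the slack \<open>k - sum_list l\<close> turns the inequality into an equality
  for lists of length \<open>n + 1\<close>, which stars and bars counts.\<close>

lemma card_lists_sum_list_le:
  "finite {l :: nat list. length l = n \<and> sum_list l \<le> k}" (is ?fin)
  "card {l :: nat list. length l = n \<and> sum_list l \<le> k} \<le> (n + k) choose n" (is ?card)
proof -
  let ?A = "{l :: nat list. length l = n \<and> sum_list l \<le> k}"
  let ?B = "{l :: nat list. length l = Suc n \<and> sum_list l = k}"
  let ?f = "\<lambda>l. (k - sum_list l) # l"
  have cB: "card ?B = (n + k) choose n"
    using card_length_sum_list[of "Suc n" k] binomial_symmetric[of k "n + k"]
    by (simp add: add.commute)
  \<comment> \<open>Infinite sets have cardinality 0 here, so a positive count also gives
    finiteness.\<close>
  then have "card ?B > 0" by simp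
  then have fB: "finite ?B" using card_ge_0_finite by blast
  have inj: "inj_on ?f ?A" by (auto simp: inj_on_def)
  have sub: "?f ` ?A \<subseteq> ?B" by auto
  show ?fin using inj sub fB by (rule inj_on_finite)
  show ?card using card_inj_on_le[OF inj sub fB] cB by simp
qed

text \<open>Greedy choice: one index takes as much of the budget \<open>k\<close> as
  \<open>f\<close> permits and the rest is passed on, hence the induction with \<open>k\<close>
  arbitrary.\<close>

lemma exists_minorant_with_sum:
  fixes f :: "'a \<Rightarrow> nat"
  assumes "finite I"
  shows "\<exists>g. (\<forall>i\<in>I. g i \<le> f i) \<and> sum g I = min k (sum f I)"
  using assms
proof (induction I arbitrary: k)
  case (insert j I)
  obtain g where g: "\<forall>i\<in>I. g i \<le> f i" "sum g I = min (k - min k (f j)) (sum f I)"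
    using insert.IH by blast
  let ?g = "g(j := min k (f j))"
  have "sum ?g I = sum g I"
    using insert.hyps by (intro sum.cong) auto
  then have "(\<forall>i\<in>insert j I. ?g i \<le> f i) \<and> sum ?g (insert j I) = min k (sum f (insert j I))"
    using g insert.hyps by (auto simp: min_def)
  then show ?case by blast
qed simp

lemma coverable_lattice:
  assumes "0 < n"
  shows "coverable n ((n + k) choose n) (real n / real (n + k))"
proof -
  let ?L = "{l :: nat list. length l = n \<and> sum_list l \<le> k}"
  let ?U = "(\<lambda>l i. real (l ! i) / (n + k)) ` ?L"
  have "simplex_cover {..<n} (n / (n + k)) ?U"
    unfolding simplex_cover_def
  proof (intro allI impI)
    fix x :: "nat \<Rightarrow> real"
    assume x: "(\<forall>i\<in>{..<n}. 0 \<le> x i) \<and> sum x {..<n} \<le> 1"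
    define f where "f = (\<lambda>i. nat \<lfloor>(n + k) * x i\<rfloor>)"
    obtain g where g: "\<forall>i<n. g i \<le> f i" "sum g {..<n} = min k (sum f {..<n})"
      using exists_minorant_with_sum[of "{..<n}" f k] by auto
    define l where "l = map g [0..<n]"
    have l: "l \<in> ?L" "\<And>i. i < n \<Longrightarrow> l ! i = g i"
      using g(2) by (auto simp: l_def interv_sum_list_conv_sum_set_nat atLeast0LessThan)
    have f: "real (f i) \<le> (n + k) * x i" "(n + k) * x i \<le> real (f i) + 1" if "i < n" for i
    proof -
      have "0 \<le> (n + k) * x i" using x that by simp
      then show "real (f i) \<le> (n + k) * x i" "(n + k) * x i \<le> real (f i) + 1"
        unfolding f_def by linarith+
    qed
    \<comment> \<open>There are two cases for the total loss. If the sum of \<open>g\<close> was cut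
      to \<open>k\<close>, the loss is at most \<open>(n + k) - k\<close>; otherwise only rounding
      occurred, costing at most 1 per coordinate. Both give \<open>n\<close>.\<close>
    have "(n + k) * (\<Sum>i<n. x i) \<le> real (n + k) * 1"
      using x by (intro mult_left_mono) auto
    moreover have "(n + k) * (\<Sum>i<n. x i) \<le> (\<Sum>i<n. real (f i) + 1)"
      unfolding sum_distrib_left using f by (intro sum_mono) auto
    ultimately have "(n + k) * (\<Sum>i<n. x i) - real (sum g {..<n}) \<le> n"
      unfolding g(2) by (auto simp: sum.distrib min_def)
    moreover have "(\<Sum>i<n. x i - real (l ! i) / (n + k)) = ((n + k) * (\<Sum>i<n. x i) - real (sum g {..<n})) / (n + k)"
      using assms l(2) by (simp add: sum_subtractf sum_divide_distrib diff_divide_distrib)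
    ultimately have "(\<Sum>i<n. x i - real (l ! i) / (n + k)) \<le> n / (n + k)"
      by (simp add: divide_right_mono)
    moreover have "real (l ! i) / (n + k) \<le> x i" if "i < n" for i
    proof -
      have "real (g i) \<le> (n + k) * x i"
        using g(1) f(1) that by (meson of_nat_le_iff order_trans)
      then show ?thesis using assms l(2) that by (simp add: pos_divide_le_eq mult.commute)
    qed
    ultimately show "\<exists>u\<in>?U. (\<forall>i\<in>{..<n}. u i \<le> x i) \<and> (\<Sum>i<n. x i - u i) \<le> n / (n + k)"
      by (intro bexI[of _ "\<lambda>i. real (l ! i) / (n + k)"] imageI l(1)) auto
  qed
  moreover have "finite ?U"
    using card_lists_sum_list_le(1) by (rule finite_imageI)
  moreover have "card ?U \<le> (n + k) choose n"
    using card_image_le[OF card_lists_sum_list_le(1)] card_lists_sum_list_le(2) by (rule le_trans)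
  ultimately show ?thesis unfolding coverable_def by (intro exI[of _ ?U] conjI)
qed

section \<open>Covers assembled from blocks of coordinates\<close>

lemma coverable_join:
  assumes cov: "coverable m M t" and "0 \<le> t" "0 < C"
  shows "coverable (q * m) (2 ^ ((C + 2) * q) * M ^ q) (t * (1 + 1 / C))"
proof (cases "q = 0")
  case True
  have "simplex_cover {..<0 :: nat} (t * (1 + 1 / C)) {\<lambda>_. 0}"
    using assms by (simp add: simplex_cover_def)
  then show ?thesis
    unfolding True coverable_def by (intro exI[of _ "{\<lambda>_. 0}"]) auto
next
  case False
  obtain U where U: "finite U" "card U \<le> M" "simplex_cover {..<m} t U"
    using cov unfolding coverable_def by blast
  \<comment> \<open>Block masses are rounded up to multiples of \<open>1 / K\<close>. The
    \<open>q\<close> roundings add at most \<open>q / K = 1 / C\<close> to the total mass, which is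
    the loss factor in the ratio.\<close>
  define K where "K = C * q"
  have K: "0 < K" using assms False by (simp add: K_def)
  let ?L = "{l :: nat list. length l = q \<and> sum_list l \<le> q + K}"
  let ?W = "{..<q} \<rightarrow>\<^sub>E U"
  \<comment> \<open>A translate is encoded by the rounded masses \<open>l\<close> and a choice
    \<open>w\<close> of one covering vector per block.\<close>
  let ?code = "\<lambda>(l, w) (k, i). real (l ! k) / K * w k i"
  let ?V = "?code ` (?L \<times> ?W)"
  have cover: "simplex_cover ({..<q} \<times> {..<m}) (t * (1 + 1 / C)) ?V"
    unfolding simplex_cover_def
  proof (intro allI impI)
    fix x :: "nat \<times> nat \<Rightarrow> real"
    assume x: "(\<forall>p\<in>{..<q} \<times> {..<m}. 0 \<le> x p) \<and> sum x ({..<q} \<times> {..<m}) \<le> 1"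
    define s where "s k = (\<Sum>i<m. x (k, i))" for k
    define b where "b k = nat \<lceil>K * s k\<rceil>" for k
    define l where "l = map b [0..<q]"
    have l_nth: "l ! k = b k" if "k < q" for k using that by (simp add: l_def)
    have s0: "0 \<le> s k" if "k < q" for k
      using x that unfolding s_def by (intro sum_nonneg) auto
    have sum_s: "(\<Sum>k<q. s k) \<le> 1"
      using x by (simp add: s_def sum.cartesian_product)
    have b: "K * s k \<le> b k" "b k \<le> K * s k + 1" if "k < q" for k
    proof -
      have "0 \<le> K * s k" using s0[OF that] by simp
      then show "K * s k \<le> b k" "b k \<le> K * s k + 1"
        unfolding b_def by linarith+
    qed
    have "real (\<Sum>k<q. b k) \<le> (\<Sum>k<q. K * s k + 1)"
      using b by (auto intro: sum_mono)
    also have "\<dots> \<le> K + q"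
      using mult_left_mono[OF sum_s, of "real K"]
      by (simp add: sum.distrib flip: sum_distrib_left)
    finally have sum_b: "(\<Sum>k<q. b k) \<le> q + K" by linarith
    have "\<exists>u. u \<in> U \<and> (\<forall>i\<in>{..<m}. b k / K * u i \<le> x (k, i)) \<and>
        (\<Sum>i<m. x (k, i) - b k / K * u i) \<le> b k / K * t"
      if "k < q" for k
    proof -
      have "s k \<le> b k / K" using b(1)[OF that] K by (simp add: pos_le_divide_eq mult.commute)
      then have le: "(\<Sum>i<m. x (k, i)) \<le> b k / K" by (simp add: s_def)
      have pos: "0 \<le> real (b k) / K" "\<forall>i\<in>{..<m}. 0 \<le> x (k, i)" using x that by auto
      from simplex_cover_scale[OF U(3) finite_lessThan pos le]
      obtain u where "u \<in> U" "\<forall>i\<in>{..<m}. b k / K * u i \<le> x (k, i)"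
          "(\<Sum>i<m. x (k, i) - b k / K * u i) \<le> b k / K * t" .
      then show ?thesis by blast
    qed
    then have "\<forall>k\<in>{..<q}. \<exists>u. u \<in> U \<and> (\<forall>i\<in>{..<m}. b k / K * u i \<le> x (k, i)) \<and>
        (\<Sum>i<m. x (k, i) - b k / K * u i) \<le> b k / K * t"
      by simp
    from bchoice[OF this]
    obtain w where "\<forall>k\<in>{..<q}. w k \<in> U \<and> (\<forall>i\<in>{..<m}. b k / K * w k i \<le> x (k, i)) \<and>
        (\<Sum>i<m. x (k, i) - b k / K * w k i) \<le> b k / K * t" ..
    then have w: "\<And>k. k < q \<Longrightarrow> w k \<in> U"
        "\<And>k i. k < q \<Longrightarrow> i < m \<Longrightarrow> b k / K * w k i \<le> x (k, i)"
        "\<And>k. k < q \<Longrightarrow> (\<Sum>i<m. x (k, i) - b k / K * w k i) \<le> b k / K * t"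
      by simp_all
    let ?v = "?code (l, restrict w {..<q})"
    have "l \<in> ?L"
      using sum_b by (simp add: l_def interv_sum_list_conv_sum_set_nat atLeast0LessThan)
    then have v: "?v \<in> ?V" using w(1) by (intro imageI) auto
    have "(\<Sum>p\<in>{..<q} \<times> {..<m}. x p - ?v p) =
        (\<Sum>p\<in>{..<q} \<times> {..<m}. x p - b (fst p) / K * w (fst p) (snd p))"
      by (intro sum.cong) (auto simp: l_nth)
    also have "\<dots> = (\<Sum>k<q. \<Sum>i<m. x (k, i) - b k / K * w k i)"
      by (simp add: sum.cartesian_product split_def)
    also have "\<dots> \<le> (\<Sum>k<q. b k / K * t)"
      using w(3) by (intro sum_mono) auto
    also have "\<dots> = real (\<Sum>k<q. b k) / K * t"
      by (simp add: sum_distrib_right sum_divide_distrib)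
    also have "\<dots> \<le> real (q + K) / K * t"
      using assms by (intro mult_right_mono divide_right_mono of_nat_mono sum_b) auto
    also have "\<dots> = t * (1 + 1 / C)"
      using False assms by (simp add: K_def field_simps)
    finally have "(\<Sum>p\<in>{..<q} \<times> {..<m}. x p - ?v p) \<le> t * (1 + 1 / C)" .
    moreover have "\<forall>p\<in>{..<q} \<times> {..<m}. ?v p \<le> x p"
      using w(2) by (auto simp: l_nth)
    ultimately show "\<exists>v\<in>?V. (\<forall>p\<in>{..<q} \<times> {..<m}. v p \<le> x p) \<and>
        (\<Sum>p\<in>{..<q} \<times> {..<m}. x p - v p) \<le> t * (1 + 1 / C)"
      using v by blast
  qed
  have finLW: "finite (?L \<times> ?W)"
    using card_lists_sum_list_le(1)[of q "q + K"] U(1) by (auto intro: finite_PiE)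
  have "card ?V \<le> card (?L \<times> ?W)" using finLW by (rule card_image_le)
  also have "\<dots> \<le> ((q + (q + K)) choose q) * M ^ q"
    unfolding card_cartesian_product
    using card_lists_sum_list_le(2)[of q "q + K"] U
    by (intro mult_mono) (auto simp: card_PiE power_mono)
  \<comment> \<open>The crude bound on the binomial suffices: it is exponential in the number of
    blocks \<open>q\<close>, not in the dimension \<open>q * m\<close>.\<close>
  also have "\<dots> \<le> 2 ^ (q + (q + K)) * M ^ q"
    by (intro mult_right_mono binomial_le_pow2) auto
  also have "q + (q + K) = (C + 2) * q" by (simp add: K_def algebra_simps)
  finally have "card ?V \<le> 2 ^ ((C + 2) * q) * M ^ q" .
  then show ?thesis
    using finLW cover by (intro coverableI[of "{..<q} \<times> {..<m}" _ ?V]) auto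
qed

lemma coverable_drop_block:
  assumes cov: "coverable ((B - 1) * s) M t" and "0 < B"
  shows "coverable (B * s) (B * M) (t + 1 / B)"
proof -
  let ?I = "\<lambda>k. ({..<B} - {k}) \<times> {..<s}"
  have "\<exists>U. finite U \<and> card U \<le> M \<and> simplex_cover (?I k) t U" if "k < B" for k
  proof -
    have "card (?I k) \<le> (B - 1) * s"
      using that by (simp add: card_cartesian_product)
    then show ?thesis using coverableE[OF cov, of "?I k"] by blast
  qed
  then obtain U where U: "\<And>k. k < B \<Longrightarrow> finite (U k) \<and> card (U k) \<le> M \<and> simplex_cover (?I k) t (U k)"
    by metis
  let ?code = "\<lambda>k u p. if fst p = k then 0 else u p"
  let ?V = "\<Union>k<B. ?code k ` U k"
  have "simplex_cover ({..<B} \<times> {..<s}) (t + 1 / B) ?V"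
    unfolding simplex_cover_def
  proof (intro allI impI)
    fix x :: "nat \<times> nat \<Rightarrow> real"
    assume x: "(\<forall>p\<in>{..<B} \<times> {..<s}. 0 \<le> x p) \<and> sum x ({..<B} \<times> {..<s}) \<le> 1"
    \<comment> \<open>By averaging, some block is this light. Using zero there loses at most
      \<open>1 / B\<close>; the choice of the block accounts for the factor \<open>B\<close> in the
      number of translates.\<close>
    have "\<exists>k<B. (\<Sum>i<s. x (k, i)) \<le> 1 / B"
    proof (rule ccontr)
      assume "\<not> ?thesis"
      then have "(\<Sum>k<B. 1 / B) < (\<Sum>k<B. \<Sum>i<s. x (k, i))"
        using assms by (intro sum_strict_mono) (auto simp: not_le lessThan_empty_iff)
      then show False using x assms by (simp add: sum.cartesian_product)
    qed
    then obtain k where k: "k < B" "(\<Sum>i<s. x (k, i)) \<le> 1 / B" by blast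
    have split: "sum f ({..<B} \<times> {..<s}) = sum f (?I k) + (\<Sum>i<s. f (k, i))" for f :: "nat \<times> nat \<Rightarrow> real"
    proof -
      have "sum f ({..<B} \<times> {..<s}) = (\<Sum>k'<B. \<Sum>i<s. f (k', i))"
        by (simp add: sum.cartesian_product)
      also have "\<dots> = (\<Sum>i<s. f (k, i)) + (\<Sum>k'\<in>{..<B} - {k}. \<Sum>i<s. f (k', i))"
        using k by (intro sum.remove) auto
      finally show ?thesis by (simp add: sum.cartesian_product)
    qed
    have "sum x (?I k) \<le> 1"
      using split[of x] x k sum_nonneg[of "{..<s}" "\<lambda>i. x (k, i)"] by auto
    then obtain u where u: "u \<in> U k" "\<forall>p\<in>?I k. u p \<le> x p" "(\<Sum>p\<in>?I k. x p - u p) \<le> t"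
      using simplex_coverE[of "?I k" t "U k" x] U[OF k(1)] x by blast
    have "(\<Sum>p\<in>?I k. x p - ?code k u p) = (\<Sum>p\<in>?I k. x p - u p)"
      by (intro sum.cong) auto
    then have "(\<Sum>p\<in>{..<B} \<times> {..<s}. x p - ?code k u p) \<le> t + 1 / B"
      using split[of "\<lambda>p. x p - ?code k u p"] u(3) k(2) by simp
    moreover have "\<forall>p\<in>{..<B} \<times> {..<s}. ?code k u p \<le> x p"
      using u(2) x by auto
    ultimately show "\<exists>v\<in>?V. (\<forall>p\<in>{..<B} \<times> {..<s}. v p \<le> x p) \<and>
        (\<Sum>p\<in>{..<B} \<times> {..<s}. x p - v p) \<le> t + 1 / B"
      using u(1) k(1) by (intro bexI[of _ "?code k u"]) auto
  qed
  moreover have "card ?V \<le> (\<Sum>k<B. card (?code k ` U k))"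
    by (intro card_UN_le) auto
  moreover have "(\<Sum>k<B. card (?code k ` U k)) \<le> (\<Sum>k<B. M)"
    using U by (intro sum_mono) (meson card_image_le lessThan_iff le_trans)
  ultimately show ?thesis
    using U by (intro coverableI[of "{..<B} \<times> {..<s}" _ ?V]) auto
qed

subsection \<open>The covering functional is attained\<close>

text \<open>Indexed families match the definition of \<open>covering_functional\<close> and form a
  product space for the compactness argument. Indices from \<open>card U\<close> up to
  \<open>M\<close> carry arbitrary vectors.\<close>

lemma coverable_iff_family:
  "coverable n M t \<longleftrightarrow>
     (\<exists>u :: nat \<Rightarrow> nat \<Rightarrow> real. \<forall>x. (\<forall>i<n. 0 \<le> x i) \<and> sum x {..<n} \<le> 1 \<longrightarrow>
        (\<exists>j<M. (\<forall>i<n. u j i \<le> x i) \<and> (\<Sum>i<n. x i - u j i) \<le> t))"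
proof
  assume "coverable n M t"
  then obtain U :: "(nat \<Rightarrow> real) set" where U: "finite U" "card U \<le> M" "simplex_cover {..<n} t U"
    unfolding coverable_def by blast
  obtain u where "bij_betw u {0..<card U} U"
    using ex_bij_betw_nat_finite[OF U(1)] by blast
  then have u: "U = u ` {..<card U}"
    by (simp add: bij_betw_def atLeast0LessThan)
  show "\<exists>u :: nat \<Rightarrow> nat \<Rightarrow> real. \<forall>x. (\<forall>i<n. 0 \<le> x i) \<and> sum x {..<n} \<le> 1 \<longrightarrow>
        (\<exists>j<M. (\<forall>i<n. u j i \<le> x i) \<and> (\<Sum>i<n. x i - u j i) \<le> t)"
  proof (intro exI[of _ u] allI impI)
    fix x :: "nat \<Rightarrow> real"
    assume "(\<forall>i<n. 0 \<le> x i) \<and> sum x {..<n} \<le> 1"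
    then obtain v where v: "v \<in> U" "\<forall>i<n. v i \<le> x i" "(\<Sum>i<n. x i - v i) \<le> t"
      using U(3) unfolding simplex_cover_def by (metis lessThan_iff)
    obtain j where "j < card U" "v = u j" using v(1) u by auto
    then show "\<exists>j<M. (\<forall>i<n. u j i \<le> x i) \<and> (\<Sum>i<n. x i - u j i) \<le> t"
      using v U(2) by (intro exI[of _ j]) auto
  qed
next
  assume "\<exists>u :: nat \<Rightarrow> nat \<Rightarrow> real. \<forall>x. (\<forall>i<n. 0 \<le> x i) \<and> sum x {..<n} \<le> 1 \<longrightarrow>
        (\<exists>j<M. (\<forall>i<n. u j i \<le> x i) \<and> (\<Sum>i<n. x i - u j i) \<le> t)"
  then obtain u :: "nat \<Rightarrow> nat \<Rightarrow> real" where u: "\<And>x. (\<forall>i<n. 0 \<le> x i) \<and> sum x {..<n} \<le> 1 \<Longrightarrow>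
        (\<exists>j<M. (\<forall>i<n. u j i \<le> x i) \<and> (\<Sum>i<n. x i - u j i) \<le> t)"
    by blast
  have "simplex_cover {..<n} t (u ` {..<M})"
    using u unfolding simplex_cover_def by (simp add: Bex_def) blast
  moreover have "card (u ` {..<M}) \<le> M"
    using card_image_le[of "{..<M}" u] by simp
  ultimately show "coverable n M t" unfolding coverable_def by blast
qed

lemma covers_iff_coverable:
  assumes "0 < t"
  shows "(\<exists>u :: nat \<Rightarrow> nat \<Rightarrow> real. (\<forall>j<M. u j \<in> Rn n) \<and>
            corner_simplex n \<subseteq> (\<Union>j<M. homothet t (corner_simplex n) (u j))) \<longleftrightarrow> coverable n M t"
    (is "?L \<longleftrightarrow> _")
proof
  assume ?L
  then obtain u :: "nat \<Rightarrow> nat \<Rightarrow> real"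
    where u: "corner_simplex n \<subseteq> (\<Union>j<M. homothet t (corner_simplex n) (u j))" by blast
  show "coverable n M t"
    unfolding coverable_iff_family
  proof (intro exI[of _ u] allI impI)
    fix x :: "nat \<Rightarrow> real"
    assume x: "(\<forall>i<n. 0 \<le> x i) \<and> sum x {..<n} \<le> 1"
    let ?x = "\<lambda>i. if i < n then x i else 0"
    have "?x \<in> corner_simplex n"
      using x by (simp add: corner_simplex_def topspace_Euclidean_space)
    then obtain j y where j: "j < M" and y: "y \<in> corner_simplex n" "?x = (\<lambda>i. t * y i + u j i)"
      using u unfolding homothet_def by blast
    have xy: "x i = t * y i + u j i" if "i < n" for i
      using fun_cong[OF y(2), of i] that by simp
    have "(\<Sum>i<n. x i - u j i) = t * (\<Sum>i<n. y i)"
      by (simp add: xy sum_distrib_left)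
    also have "\<dots> \<le> t * 1"
      using y(1) assms by (intro mult_left_mono) (auto simp: corner_simplex_def)
    finally have "(\<Sum>i<n. x i - u j i) \<le> t" by simp
    moreover have "\<forall>i<n. u j i \<le> x i"
      using y(1) assms by (auto simp: xy corner_simplex_def)
    ultimately show "\<exists>j<M. (\<forall>i<n. u j i \<le> x i) \<and> (\<Sum>i<n. x i - u j i) \<le> t"
      using j by blast
  qed
next
  assume "coverable n M t"
  then obtain u :: "nat \<Rightarrow> nat \<Rightarrow> real" where u: "\<And>x. (\<forall>i<n. 0 \<le> x i) \<and> sum x {..<n} \<le> 1 \<Longrightarrow>
        (\<exists>j<M. (\<forall>i<n. u j i \<le> x i) \<and> (\<Sum>i<n. x i - u j i) \<le> t)"
    unfolding coverable_iff_family by blast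
  \<comment> \<open>Covering vectors are unconstrained outside the first \<open>n\<close>
    coordinates; zeroing these entries places them in \<open>Rn n\<close>.\<close>
  define v where "v = (\<lambda>j i. if i < n then u j i else 0)"
  have "corner_simplex n \<subseteq> (\<Union>j<M. homothet t (corner_simplex n) (v j))"
  proof
    fix x assume x: "x \<in> corner_simplex n"
    then obtain j where j: "j < M" "\<forall>i<n. u j i \<le> x i" "(\<Sum>i<n. x i - u j i) \<le> t"
      using u[of x] by (auto simp: corner_simplex_def)
    let ?y = "\<lambda>i. (x i - v j i) / t"
    have "(\<Sum>i<n. ?y i) = (\<Sum>i<n. x i - u j i) / t"
      by (simp add: v_def sum_divide_distrib)
    then have "?y \<in> corner_simplex n"
      using x j assms by (auto simp: corner_simplex_def topspace_Euclidean_space v_def)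
    moreover have "x = (\<lambda>i. t * ?y i + v j i)"
      using assms by simp
    ultimately have "x \<in> homothet t (corner_simplex n) (v j)"
      unfolding homothet_def by (intro image_eqI[where x = ?y])
    then show "x \<in> (\<Union>j<M. homothet t (corner_simplex n) (v j))"
      using j(1) by blast
  qed
  moreover have "\<forall>j<M. v j \<in> Rn n"
    by (simp add: v_def topspace_Euclidean_space)
  ultimately show ?L by blast
qed

lemma coverable_one: "0 < M \<Longrightarrow> coverable n M 1"
  unfolding coverable_iff_family by (intro exI[of _ "\<lambda>_ _. 0"]) auto

lemma coverable_nonneg:
  assumes "coverable n M t"
  shows "0 \<le> t"
proof -
  obtain U :: "(nat \<Rightarrow> real) set" where "simplex_cover {..<n} t U"
    using assms unfolding coverable_def by blast
  moreover have "\<forall>i\<in>{..<n}. (0::real) \<le> 0" "(\<Sum>i<n. 0::real) \<le> 1" by simp_all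
  ultimately obtain u where "u \<in> U" "\<forall>i\<in>{..<n}. u i \<le> 0" "(\<Sum>i<n. 0 - u i) \<le> t"
    by (rule simplex_coverE)
  then show ?thesis
    using sum_nonneg[of "{..<n}" "\<lambda>i. 0 - u i"] by auto
qed

text \<open>Ratio 0 forces the covering vector to agree with the point, so the finite set
  \<open>U\<close> would have to contain infinitely many values of the first coordinate along an
  edge.\<close>

lemma not_coverable_zero:
  assumes "0 < n"
  shows "\<not> coverable n M 0"
proof
  assume "coverable n M 0"
  then obtain U :: "(nat \<Rightarrow> real) set" where U: "finite U" "simplex_cover {..<n} 0 U"
    unfolding coverable_def by blast
  have "{0..1} \<subseteq> (\<lambda>u. u 0) ` U"
  proof
    fix r :: real assume r: "r \<in> {0..1}"
    let ?x = "\<lambda>i::nat. if i = 0 then r else 0"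
    have "\<forall>i\<in>{..<n}. 0 \<le> ?x i" "sum ?x {..<n} \<le> 1"
      using r assms by simp_all
    from simplex_coverE[OF U(2) this]
    obtain u where u: "u \<in> U" "\<forall>i\<in>{..<n}. u i \<le> ?x i" "(\<Sum>i<n. ?x i - u i) \<le> 0" .
    have "(\<Sum>i<n. ?x i - u i) = 0"
      using u(2,3) by (intro order_antisym sum_nonneg) auto
    moreover have "\<forall>i\<in>{..<n}. 0 \<le> ?x i - u i" using u(2) by auto
    ultimately have "\<forall>i\<in>{..<n}. ?x i - u i = 0"
      by (subst (asm) sum_nonneg_eq_0_iff) auto
    then have "?x 0 - u 0 = 0" using assms by blast
    then show "r \<in> (\<lambda>u. u 0) ` U" using u(1) by auto
  qed
  then have "finite {0..1 :: real}"
    using U(1) finite_surj by blast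
  then show False by (simp add: infinite_Icc)
qed

text \<open>Minimise the ratio over a compact set of pairs (family, ratio). Clamping the entries of
  the vectors to \<open>[0, 1]\<close> preserves covering, and ratios above 1 cannot be
  minimal.\<close>

lemma coverable_attains_minimum:
  assumes "0 < M"
  obtains t where "coverable n M t" "\<And>s. coverable n M s \<Longrightarrow> t \<le> s"
proof -
  let ?S = "{x :: nat \<Rightarrow> real. (\<forall>i<n. 0 \<le> x i) \<and> sum x {..<n} \<le> 1}"
  let ?ok = "\<lambda>(z :: (nat \<times> nat \<Rightarrow> real) \<times> real) x j. (\<forall>i<n. fst z (j, i) \<le> x i) \<and> (\<Sum>i<n. x i - fst z (j, i)) \<le> snd z"
  let ?box = "(UNIV \<rightarrow>\<^sub>E {0..1}) \<times> {0..1} :: ((nat \<times> nat \<Rightarrow> real) \<times> real) set"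
  let ?F = "{z. \<forall>x\<in>?S. \<exists>j<M. ?ok z x j}"
  have coord: "continuous_on UNIV (\<lambda>z :: (nat \<times> nat \<Rightarrow> real) \<times> real. fst z p)" for p
    by (rule continuous_on_product_then_coordinatewise[OF continuous_on_fst[OF continuous_on_id]])
  have "closed {z. ?ok z x j}" for x j
  proof -
    have "closed {z :: (nat \<times> nat \<Rightarrow> real) \<times> real. fst z (j, i) \<le> x i}" for i
      by (intro closed_Collect_le coord continuous_on_const)
    then have "closed (\<Inter>i<n. {z :: (nat \<times> nat \<Rightarrow> real) \<times> real. fst z (j, i) \<le> x i})" by auto
    moreover have "closed {z :: (nat \<times> nat \<Rightarrow> real) \<times> real. (\<Sum>i<n. x i - fst z (j, i)) \<le> snd z}"
      by (intro closed_Collect_le continuous_intros coord)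
    moreover have "{z. ?ok z x j} = (\<Inter>i<n. {z. fst z (j, i) \<le> x i}) \<inter> {z. (\<Sum>i<n. x i - fst z (j, i)) \<le> snd z}"
      by auto
    ultimately show ?thesis by (simp only: closed_Int)
  qed
  \<comment> \<open>For each point the union over \<open>j < M\<close> is finite, hence closed;
    arbitrary intersections over the points stay closed.\<close>
  then have "closed (\<Inter>x\<in>?S. \<Union>j<M. {z. ?ok z x j})"
    by (intro closed_INT ballI closed_UN) auto
  moreover have "?F = (\<Inter>x\<in>?S. \<Union>j<M. {z. ?ok z x j})"
    by (simp add: set_eq_iff Bex_def)
  ultimately have "closed ?F" by (simp only:)
  \<comment> \<open>Tychonoff's theorem, with the product topology being the standard one on this
    function space.\<close>
  moreover have "compact (UNIV \<rightarrow>\<^sub>E {0..1} :: (nat \<times> nat \<Rightarrow> real) set)"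
    using compactin_PiE[of "\<lambda>_. euclidean" UNIV "\<lambda>_ :: nat \<times> nat. {0..1 :: real}"]
    by (simp add: euclidean_product_topology)
  then have "compact ?box" by (intro compact_Times) auto
  ultimately have compact: "compact (?box \<inter> ?F)" by (rule compact_Int_closed[rotated])
  have member: "((\<lambda>(j, i). max 0 (min 1 (u j i))), s) \<in> ?box \<inter> ?F"
    if "s \<in> {0..1}" and u: "\<forall>x\<in>?S. \<exists>j<M. ?ok (\<lambda>(j, i). u j i, s) x j" for u s
  proof -
    have "\<exists>j<M. ?ok (\<lambda>(j, i). max 0 (min 1 (u j i)), s) x j" if x: "x \<in> ?S" for x
    proof -
      obtain j where j: "j < M" "\<forall>i<n. u j i \<le> x i" "(\<Sum>i<n. x i - u j i) \<le> s"
        using u x by auto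
      have le1: "x i \<le> 1" if "i < n" for i
        using member_le_sum[of i "{..<n}" x] x that by auto
      have "\<forall>i<n. max 0 (min 1 (u j i)) \<le> x i" using j(2) x by auto
      moreover have "(\<Sum>i<n. x i - max 0 (min 1 (u j i))) \<le> (\<Sum>i<n. x i - u j i)"
        \<comment> \<open>Since \<open>u j i <= x i <= 1\<close>, clamping at 1 changes nothing, and
          clamping at 0 only raises the vector and so reduces the loss.\<close>
        using j(2) le1 by (intro sum_mono) force
      ultimately show ?thesis using j by auto
    qed
    then show ?thesis using that(1) by auto
  qed
  have "((\<lambda>(j, i). max 0 (min 1 0)), 1) \<in> ?box \<inter> ?F"
    by (rule member) (use assms in auto)
  then have "?box \<inter> ?F \<noteq> {}" by blast
  then obtain z where z: "z \<in> ?box \<inter> ?F" "\<forall>y\<in>?box \<inter> ?F. snd z \<le> snd y"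
    using continuous_attains_inf[OF compact, of snd] continuous_on_snd[OF continuous_on_id] by blast
  show thesis
  proof
    show "coverable n M (snd z)"
      unfolding coverable_iff_family using z(1) by (intro exI[of _ "\<lambda>j i. fst z (j, i)"]) auto
    show "snd z \<le> s" if cov: "coverable n M s" for s
    proof (cases "s \<le> 1")
      case True
      have "s \<in> {0..1}" using True coverable_nonneg[OF cov] by simp
      moreover obtain u :: "nat \<Rightarrow> nat \<Rightarrow> real" where "\<forall>x\<in>?S. \<exists>j<M. ?ok (\<lambda>(j, i). u j i, s) x j"
        using cov unfolding coverable_iff_family by auto
      ultimately show ?thesis using bspec[OF z(2) member] by simp
    next
      case False
      then show ?thesis using z(1) by auto
    qed
  qed
qed

abbreviation gamma_simplex :: "nat \<Rightarrow> real" where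
  "gamma_simplex n \<equiv> covering_functional n (2 ^ n) (corner_simplex n)"

lemma covering_functional_corner_simplex:
  assumes "0 < n" "0 < M"
  shows "coverable n M (covering_functional n M (corner_simplex n))"
    and "coverable n M t \<Longrightarrow> covering_functional n M (corner_simplex n) \<le> t"
proof -
  obtain s where s: "coverable n M s" "\<And>t. coverable n M t \<Longrightarrow> s \<le> t"
    using coverable_attains_minimum[OF assms(2)] by blast
  \<comment> \<open>The functional minimises over positive ratios only, so the minimum from
    compactness must be shown to be positive.\<close>
  have "0 < s"
    using coverable_nonneg[OF s(1)] not_coverable_zero[OF assms(1)] s(1) by (cases "s = 0") auto
  then have "covering_functional n M (corner_simplex n) = s"
    unfolding covering_functional_def
    using s covers_iff_coverable[of _ M n] by (intro Least_equality) blast+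
  then show "coverable n M (covering_functional n M (corner_simplex n))"
    and "coverable n M t \<Longrightarrow> covering_functional n M (corner_simplex n) \<le> t"
    using s by auto
qed

subsection \<open>Convergence\<close>

lemma coverable_amplify:
  assumes cov: "coverable m (2 ^ m) t" and "0 < B" and m: "B * (B + 2) \<le> m"
    and n: "2 * B ^ 3 + (B + 1) * B * m \<le> n"
  shows "coverable n (2 ^ n) (t + (t + 1) / B)"
proof -
  \<comment> \<open>\<open>B\<close> blocks of size \<open>s\<close> hold all \<open>n\<close>
    coordinates; after one is dropped, \<open>q\<close> blocks of size \<open>m\<close> hold the
    remaining ones.\<close>
  define s where "s = n div B + 1"
  define q where "q = (B - 1) * s div m + 1"
  have "0 < B * (B + 2)" using assms by simp
  then have m0: "0 < m" using m by linarith
  have n_le: "n \<le> B * s" and Bs: "B * s \<le> n + B"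
    using assms(2) dividend_less_div_times[of B n] div_times_less_eq_dividend[of n B]
    by (auto simp: s_def algebra_simps)
  have s_le: "(B - 1) * s \<le> q * m" and mq: "q * m \<le> (B - 1) * s + m"
    using m0 dividend_less_div_times[of m "(B - 1) * s"] div_times_less_eq_dividend[of "(B - 1) * s" m]
    by (auto simp: q_def algebra_simps)
  \<comment> \<open>Since \<open>B + 2 <= m / B\<close> and \<open>q * m\<close> is about
    \<open>(1 - 1/B) n\<close>, the main term is about
    \<open>(1 + 1/B) (1 - 1/B) n = n - n / B^2\<close>. The lower bound on \<open>n\<close> makes
    the gap \<open>n / B^2\<close> absorb all remaining terms.\<close>
  have exponent: "B + (B + 2 + m) * q \<le> n"
  proof -
    obtain b where b: "B = Suc b" using assms(2) gr0_implies_Suc by blast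
    have "B * ((B + 2 + m) * q) = (B * (B + 2)) * q + B * (q * m)"
      by (simp add: algebra_simps)
    also have "\<dots> \<le> m * q + B * (q * m)"
      using m by (intro add_mono mult_right_mono) auto
    also have "\<dots> = (B + 1) * (q * m)"
      by (simp add: algebra_simps)
    also have "\<dots> \<le> (B + 1) * ((B - 1) * s + m)"
      using mq by (rule mult_left_mono) simp
    finally have "B * (B * ((B + 2 + m) * q)) \<le> B * ((B + 1) * ((B - 1) * s + m))"
      by (rule mult_left_mono) simp
    also have "\<dots> = (B + 1) * ((B - 1) * (B * s) + B * m)"
      unfolding b by (simp add: algebra_simps)
    also have "\<dots> \<le> (B + 1) * ((B - 1) * (n + B) + B * m)"
      using Bs by (intro mult_left_mono add_mono) auto
    finally have le: "B * (B * ((B + 2 + m) * q)) \<le> (B + 1) * ((B - 1) * (n + B) + B * m)" .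
    have "B * B * (B + (B + 2 + m) * q) \<le> B * B * n"
      using le n unfolding b by (simp add: algebra_simps power3_eq_cube)
    then show ?thesis using assms(2) by simp
  qed
  have "0 \<le> t" using cov by (rule coverable_nonneg)
  then have "coverable (q * m) (2 ^ ((B + 2) * q) * (2 ^ m) ^ q) (t * (1 + 1 / B))"
    using cov assms(2) by (intro coverable_join)
  then have "coverable ((B - 1) * s) (2 ^ ((B + 2 + m) * q)) (t * (1 + 1 / B))"
    using s_le by (rule coverable_mono) (simp_all add: power_mult power_add power_mult_distrib)
  then have "coverable (B * s) (B * 2 ^ ((B + 2 + m) * q)) (t * (1 + 1 / B) + 1 / B)"
    using assms(2) by (rule coverable_drop_block)
  moreover have "B * 2 ^ ((B + 2 + m) * q) \<le> 2 ^ n"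
  proof -
    \<comment> \<open>The factor \<open>B\<close> for the dropped block is absorbed into the
      exponent.\<close>
    have "B * 2 ^ ((B + 2 + m) * q) \<le> 2 ^ B * 2 ^ ((B + 2 + m) * q)"
      by (intro mult_right_mono less_imp_le[OF less_exp]) auto
    also have "\<dots> \<le> 2 ^ n"
      unfolding power_add[symmetric] using exponent by (intro power_increasing) auto
    finally show ?thesis .
  qed
  moreover have "t * (1 + 1 / B) + 1 / B \<le> t + (t + 1) / B"
    by (simp add: add_divide_distrib distrib_left)
  ultimately show ?thesis using n_le coverable_mono by blast
qed

text \<open>Take a convergent subsequence with limit \<open>l\<close>. Comparing late terms with an
  earlier subsequence term bounds them above by nearly \<open>l\<close>; comparing still later
  subsequence terms with a given late term bounds it below.\<close>

lemma convergent_if_eventually_almost_below: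
  fixes g :: "nat \<Rightarrow> real"
  assumes bounded: "bounded (range g)"
    and below: "\<And>e. 0 < e \<Longrightarrow> \<exists>m0. \<forall>m\<ge>m0. \<exists>N. \<forall>n\<ge>N. g n \<le> g m + e"
  shows "convergent g"
proof -
  obtain l r where r: "strict_mono r" and lim: "(g \<circ> r) \<longlonglongrightarrow> l"
    using bounded_imp_convergent_subsequence[OF bounded] by auto
  have "g \<longlonglongrightarrow> l"
  proof (rule LIMSEQ_I)
    fix e :: real assume "0 < e"
    then have e: "0 < e / 4" by simp
    obtain m0 where m0: "\<And>m. m0 \<le> m \<Longrightarrow> \<exists>N. \<forall>n\<ge>N. g n \<le> g m + e / 4"
      using below[OF e] by blast
    obtain J where J: "\<And>j. J \<le> j \<Longrightarrow> \<bar>g (r j) - l\<bar> < e / 4"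
      using LIMSEQ_D[OF lim e] by auto
    have "m0 \<le> r (max J m0)"
      using seq_suble[OF r, of "max J m0"] by linarith
    then obtain N where N: "\<And>n. N \<le> n \<Longrightarrow> g n \<le> g (r (max J m0)) + e / 4"
      using m0 by blast
    have "norm (g n - l) < e" if n: "max N m0 \<le> n" for n
    proof -
      have upper: "g n < l + e / 2"
        using N[of n] J[of "max J m0"] n unfolding abs_less_iff by simp
      obtain N' where N': "\<And>k. N' \<le> k \<Longrightarrow> g k \<le> g n + e / 4"
        using m0[of n] n by auto
      have "N' \<le> r (max J N')"
        using seq_suble[OF r, of "max J N'"] by linarith
      then have "l - e / 2 < g n"
        using N'[of "r (max J N')"] J[of "max J N'"] unfolding abs_less_iff by simp
      then show ?thesis using upper \<open>0 < e\<close> by auto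
    qed
    then show "\<exists>no. \<forall>n\<ge>no. norm (g n - l) < e" by blast
  qed
  then show ?thesis by (rule convergentI)
qed

lemma gamma_simplex_bounds:
  assumes "0 < n"
  shows "0 \<le> gamma_simplex n" "gamma_simplex n \<le> 1"
  using covering_functional_corner_simplex[OF assms, of "2 ^ n"] coverable_nonneg coverable_one[of "2 ^ n" n]
  by auto

lemma convergent_gamma_simplex: "convergent gamma_simplex"
proof (rule convergent_if_eventually_almost_below)
  \<comment> \<open>For \<open>n = 0\<close> every positive ratio works, no minimum exists and
    \<open>LEAST\<close> is unspecified, so this value enters the bound separately.\<close>
  have "norm (gamma_simplex n) \<le> max 1 \<bar>gamma_simplex 0\<bar>" for n
    using gamma_simplex_bounds[of n] by (cases "n = 0") auto
  then show "bounded (range gamma_simplex)"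
    unfolding bounded_iff by blast
next
  fix e :: real assume e: "0 < e"
  \<comment> \<open>As the functional is at most 1, amplification costs at most
    \<open>2 / B\<close>, which this choice keeps below \<open>e\<close>.\<close>
  define B where "B = Suc (nat \<lceil>2 / e\<rceil>)"
  have "2 / e \<le> B" unfolding B_def by linarith
  then have "2 \<le> e * B" using e by (simp add: pos_divide_le_eq mult.commute)
  then have B: "2 / B \<le> e" by (simp add: B_def pos_divide_le_eq)
  have "gamma_simplex n \<le> gamma_simplex m + e"
    if m: "B * (B + 2) \<le> m" and n: "2 * B ^ 3 + (B + 1) * B * m \<le> n" for m n
  proof -
    have "0 < m" "0 < n" using m n by (auto simp: B_def)
    have "coverable m (2 ^ m) (gamma_simplex m)"
      using \<open>0 < m\<close> by (intro covering_functional_corner_simplex) auto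
    then have "coverable n (2 ^ n) (gamma_simplex m + (gamma_simplex m + 1) / B)"
      using m n by (intro coverable_amplify) (auto simp: B_def)
    then have "gamma_simplex n \<le> gamma_simplex m + (gamma_simplex m + 1) / B"
      using \<open>0 < n\<close> by (intro covering_functional_corner_simplex) auto
    also have "\<dots> \<le> gamma_simplex m + 2 / B"
      using gamma_simplex_bounds[OF \<open>0 < m\<close>] by (intro add_left_mono divide_right_mono) auto
    finally show ?thesis using B by linarith
  qed
  then show "\<exists>m0. \<forall>m\<ge>m0. \<exists>N. \<forall>n\<ge>N. gamma_simplex n \<le> gamma_simplex m + e"
    by blast
qed

subsection \<open>The constant\<close>

text \<open>A single term of the expansion of \<open>(1 + c) ^ (n + k)\<close> bounds the binomial
  by \<open>(1 + c) ^ (n + k) / c ^ k\<close>. This increases with \<open>k\<close>, and at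
  \<open>k = c * n\<close> it is the \<open>n\<close>-th power of the expression defining
  \<open>c1\<close>.\<close>

lemma binomial_le_two_power:
  assumes c: "is_c1 c" and k: "real k \<le> c * n"
  shows "(n + k) choose n \<le> 2 ^ n"
proof -
  have pos: "0 < c" and two: "(1 + c) powr (1 + c) / c powr c = 2"
    using c by (auto simp: is_c1_def)
  have "real ((n + k) choose n) * 1 ^ n * c ^ (n + k - n) \<le>
      (\<Sum>i\<le>n + k. real ((n + k) choose i) * 1 ^ i * c ^ (n + k - i))"
    using pos by (intro member_le_sum) auto
  also have "\<dots> = (1 + c) ^ (n + k)"
    by (rule binomial_ring[symmetric])
  finally have "real ((n + k) choose n) \<le> (1 + c) ^ n * ((1 + c) / c) ^ k"
    using pos by (simp add: power_add power_divide pos_le_divide_eq)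
  also have "\<dots> = (1 + c) ^ n * ((1 + c) / c) powr k"
    using pos by (simp add: powr_realpow)
  also have "\<dots> \<le> (1 + c) ^ n * ((1 + c) / c) powr (c * n)"
    using pos k by (intro mult_left_mono powr_mono) auto
  also have "\<dots> = (1 + c) powr n * ((1 + c) powr (c * n) / c powr (c * n))"
    using pos by (simp add: powr_realpow powr_divide)
  also have "\<dots> = ((1 + c) powr (1 + c) / c powr c) powr n"
    using pos by (simp add: powr_divide powr_powr distrib_right flip: powr_add)
  also have "\<dots> = 2 ^ n"
    unfolding two by (simp add: powr_realpow)
  finally have "real ((n + k) choose n) \<le> real (2 ^ n)" by simp
  then show ?thesis by (simp only: of_nat_le_iff)
qed

definition log_rate :: "real \<Rightarrow> real" where
  "log_rate c = (1 + c) * ln (1 + c) - c * ln c"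

lemma is_c1_iff_log_rate: "is_c1 c \<longleftrightarrow> 0 < c \<and> log_rate c = ln 2"
proof -
  have "(1 + c) powr (1 + c) / c powr c = 2 \<longleftrightarrow> log_rate c = ln 2" if "0 < c"
  proof -
    have "ln ((1 + c) powr (1 + c) / c powr c) = log_rate c"
      using that by (simp add: log_rate_def ln_div ln_powr)
    moreover have "0 < (1 + c) powr (1 + c) / c powr c" using that by simp
    ultimately show ?thesis by (metis ln_inj_iff zero_less_numeral)
  qed
  then show ?thesis by (auto simp: is_c1_def)
qed

lemma log_rate_strict_mono:
  assumes "0 < a" "a < b"
  shows "log_rate a < log_rate b"
proof (rule DERIV_pos_imp_increasing[OF assms(2)])
  fix x assume "a \<le> x" "x \<le> b"
  then have x: "0 < x" using assms by simp
  then have "(log_rate has_real_derivative ln (1 + x) - ln x) (at x)"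
    unfolding log_rate_def[abs_def] by (auto intro!: derivative_eq_intros)
  \<comment> \<open>The constants from the product rule cancel, leaving a difference of
    logarithms.\<close>
  moreover have "0 < ln (1 + x) - ln x" using x by simp
  ultimately show "\<exists>y. (log_rate has_real_derivative y) (at x) \<and> 0 < y" by blast
qed

text \<open>The factor \<open>4\<close> brings the argument of the logarithm close to \<open>1\<close>, where its series converges fast.\<close>

lemma log_rate_lower: "log_rate 0.2938 < ln 2"
proof -
  have "ln 0.2938 = ln (1.1752 / 4 :: real)" by simp
  also have "\<dots> = ln 1.1752 - ln (2 ^ 2)" by (subst ln_div) auto
  also have "\<dots> = ln 1.1752 - 2 * ln 2" by (subst ln_realpow) auto
  finally have "log_rate 0.2938 = 1.2938 * ln 1.2938 - 0.2938 * (ln 1.1752 - 2 * ln 2)"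
    by (simp add: log_rate_def)
  moreover have "ln 1.2938 \<le> (0.257585 :: real)"
    using ln_approx_bounds[of "1.2938" 4] by (simp add: eval_nat_numeral)
  moreover have "ln 1.1752 \<ge> (0.161437 :: real)"
    using ln_approx_bounds[of "1.1752" 4] by (simp add: eval_nat_numeral)
  \<comment> \<open>Collecting the multiples of \<open>ln 2\<close> leaves
    \<open>0.4124 * ln 2\<close> on the larger side, so a lower bound is required.\<close>
  moreover have "ln 2 \<ge> (0.69314 :: real)"
    using ln_approx_bounds[of 2 6] by (simp add: eval_nat_numeral)
  ultimately show ?thesis by (simp add: field_simps)
qed

lemma log_rate_upper: "ln 2 < log_rate 0.2939"
proof -
  have "ln 0.2939 = ln (1.1756 / 4 :: real)" by simp
  also have "\<dots> = ln 1.1756 - ln (2 ^ 2)" by (subst ln_div) auto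
  also have "\<dots> = ln 1.1756 - 2 * ln 2" by (subst ln_realpow) auto
  finally have "log_rate 0.2939 = 1.2939 * ln 1.2939 - 0.2939 * (ln 1.1756 - 2 * ln 2)"
    by (simp add: log_rate_def)
  moreover have "ln 1.2939 \<ge> (0.25766 :: real)"
    using ln_approx_bounds[of "1.2939" 4] by (simp add: eval_nat_numeral)
  moreover have "ln 1.1756 \<le> (0.16178 :: real)"
    using ln_approx_bounds[of "1.1756" 4] by (simp add: eval_nat_numeral)
  moreover have "ln 2 \<le> (0.69315 :: real)"
    using ln_approx_bounds[of 2 6] by (simp add: eval_nat_numeral)
  ultimately show ?thesis by (simp add: field_simps)
qed

lemma c1_characterization:
  "\<exists>!c. is_c1 c" "is_c1 c1" "0.2938 \<le> c1" "c1 < 0.2939"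
proof -
  have "continuous_on {0.2938..0.2939} log_rate"
    unfolding log_rate_def by (intro continuous_intros) auto
  then obtain c where c: "0.2938 \<le> c" "c \<le> 0.2939" "log_rate c = ln 2"
    using IVT'[of log_rate "0.2938" "ln 2" "0.2939"] log_rate_lower log_rate_upper by auto
  have sol: "is_c1 c" using c by (simp add: is_c1_iff_log_rate)
  have unique: "d = c" if "is_c1 d" for d
    using that sol log_rate_strict_mono[of c d] log_rate_strict_mono[of d c]
    by (cases c d rule: linorder_cases) (auto simp: is_c1_iff_log_rate)
  show ex1: "\<exists>!c. is_c1 c" using sol unique by blast
  have "c1 = c" unfolding c1_def using sol unique by (rule the_equality)
  \<comment> \<open>The intermediate value theorem on the closed interval gives only a weak upper
    bound.\<close>
  moreover have "c \<noteq> 0.2939" using c(3) log_rate_upper by (metis less_irrefl)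
  ultimately show "is_c1 c1" "0.2938 \<le> c1" "c1 < 0.2939"
    using sol c by auto
qed

subsection \<open>The upper bound\<close>

lemma lim_gamma_simplex_le: "lim gamma_simplex \<le> 1 / (1 + c1)"
proof -
  have c: "0 < c1" using c1_characterization by simp
  have le: "gamma_simplex n \<le> 1 / (1 + c1 - 1 / n)" if "2 \<le> n" for n
  proof -
    \<comment> \<open>The largest \<open>k\<close> to which \<open>binomial_le_two_power\<close>
      applies; rounding down costs the \<open>1 / n\<close> in the bound, which vanishes in the
      limit.\<close>
    define k where "k = nat \<lfloor>c1 * n\<rfloor>"
    have "0 \<le> c1 * n" using c by simp
    then have k: "real k \<le> c1 * n" "c1 * n - 1 \<le> real k"
      unfolding k_def by linarith+
    have "coverable n (2 ^ n) (real n / real (n + k))"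
      using coverable_lattice[of n k] binomial_le_two_power[OF c1_characterization(2) k(1)] that
      by (auto intro: coverable_mono)
    then have "gamma_simplex n \<le> real n / real (n + k)"
      using that by (intro covering_functional_corner_simplex) auto
    also have "\<dots> \<le> n / (n + (c1 * n - 1))"
      using k that c by (intro divide_left_mono mult_pos_pos) (auto intro: add_pos_nonneg)
    also have "\<dots> = 1 / (1 + c1 - 1 / n)"
      using that by (simp add: field_simps)
    finally show ?thesis .
  qed
  have "(\<lambda>n. 1 / (1 + c1 - 1 / real n)) \<longlonglongrightarrow> 1 / (1 + c1 - 0)"
    using c by (intro tendsto_intros lim_1_over_n) auto
  then show ?thesis
    using convergent_gamma_simplex[unfolded convergent_LIMSEQ_iff] le
    by (intro LIMSEQ_le[of gamma_simplex]) auto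
qed

theorem theorem1p1:
  shows "(\<exists>!c. is_c1 c) \<and> 0.2938 \<le> c1 \<and> c1 < 0.2939 \<and>
         convergent (\<lambda>n. covering_functional n (2 ^ n) (corner_simplex n)) \<and>
         lim (\<lambda>n. covering_functional n (2 ^ n) (corner_simplex n)) \<le> 1 / (1 + c1)"
  using c1_characterization convergent_gamma_simplex lim_gamma_simplex_le by blast

end
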